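(* Let $(X,R)$ be the 3-cyclic forcing network, let $P_n$ be an $X$-colored path, and let $P_n'$ be its color-contracted graph (a path obtained by contracting every edge of $P_n$ whose endpoints have the same color, each resulting vertex keeping that color). Then, with forcing with propagation, there is $i\in\{1,2,3\}$ such that the end states of both $P_n$ and $P_n'$ have all vertices colored $i$; that is, $\epsilon(\ell_0(P_n))=\epsilon(\ell_0(P_n'))$.
   Context: The 3-cyclic forcing network is $X=\{1,2,3\}$ with the ordered list of rules $R=(1\to 2,\,2\to 3,\,3\to 1)$. Applying a rule $a\to b$ in a forcing step means simultaneously recoloring with $a$ every vertex of color $b$ having a neighbor of color $a$; a propagating forcing step with rule $a\to b$ repeats forcing steps with that rule until no vertex of color $b$ has a neighbor of color $a$. The process with propagation applies propagating forcing steps with the rules in cyclic order $1\to2,2\to3,3\to1,1\to2,\dots$ until no rule can be applied; $\epsilon(\ell_0(\cdot))$ denotes the final coloring (end state) of the initial coloring $\ell_0(\cdot)$. *)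

theory Defs
  imports "Graph_Theory.Pair_Digraph" "HOL-Library.While_Combinator"
begin

text \<open>
  Finite simple graphs are the symmetric loop-free digraphs of the locale \<^locale>\<open>pair_graph\<close>:
  each edge is represented by its two arcs. A coloring is a total function on the vertex type;
  only its values on the vertex set are relevant.
\<close>

section \<open>Forcing networks\<close>

text \<open>The pair \<open>(a, b)\<close> is the rule \<open>a \<rightarrow> b\<close>.\<close>

record 'c forcing_network =
  colors :: "'c set"
  rules :: "('c \<times> 'c) list"

definition colored_by ::
    "'c forcing_network \<Rightarrow> 'v pair_pre_digraph \<Rightarrow> ('v \<Rightarrow> 'c) \<Rightarrow> bool" where
  "colored_by N G l \<longleftrightarrow> (\<forall>v \<in> pverts G. l v \<in> colors N)"

definition forced :: "'v pair_pre_digraph \<Rightarrow> 'c \<times> 'c \<Rightarrow> ('v \<Rightarrow> 'c) \<Rightarrow> 'v set" where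
  "forced G r l = {v \<in> pverts G. l v = snd r \<and> (\<exists>w. (v, w) \<in> parcs G \<and> l w = fst r)}"

definition applicable :: "'v pair_pre_digraph \<Rightarrow> 'c \<times> 'c \<Rightarrow> ('v \<Rightarrow> 'c) \<Rightarrow> bool" where
  "applicable G r l \<longleftrightarrow> forced G r l \<noteq> {}"

definition forcing_step ::
    "'v pair_pre_digraph \<Rightarrow> 'c \<times> 'c \<Rightarrow> ('v \<Rightarrow> 'c) \<Rightarrow> ('v \<Rightarrow> 'c)" where
  "forcing_step G r l = (\<lambda>v. if v \<in> forced G r l then fst r else l v)"

text \<open>
  On a finite graph, for a rule between two different colors, the loop terminates; see
  \<open>propagating_step_terminates\<close> below.
\<close>

definition propagating_step ::
    "'v pair_pre_digraph \<Rightarrow> 'c \<times> 'c \<Rightarrow> ('v \<Rightarrow> 'c) \<Rightarrow> ('v \<Rightarrow> 'c)" where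
  "propagating_step G r l = while (applicable G r) (forcing_step G r) l"

text \<open>
  The loop state \<open>(j, l)\<close> consists of the number \<open>j\<close> of turns taken so far and the current
  coloring. A rule that is not applicable on its turn leaves the coloring unchanged.
  The end state is \<^const>\<open>None\<close> iff the process goes on forever.
\<close>

definition end_state ::
    "'c forcing_network \<Rightarrow> 'v pair_pre_digraph \<Rightarrow> ('v \<Rightarrow> 'c) \<Rightarrow> ('v \<Rightarrow> 'c) option" where
  "end_state N G l0 = map_option snd
     (while_option
       (\<lambda>(j, l). \<exists>r \<in> set (rules N). applicable G r l)
       (\<lambda>(j, l). (Suc j, propagating_step G (rules N ! (j mod length (rules N))) l))
       (0, l0))"

definition cyclic3 :: "nat forcing_network" where
  "cyclic3 = \<lparr>colors = {1, 2, 3}, rules = [(1, 2), (2, 3), (3, 1)]\<rparr>"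

section \<open>Paths and color contraction\<close>

definition path_graph :: "nat \<Rightarrow> nat pair_pre_digraph" where
  "path_graph n = \<lparr>pverts = {1..n},
     parcs = {(u, v). u \<in> {1..n} \<and> v \<in> {1..n} \<and> (v = Suc u \<or> u = Suc v)}\<rparr>"

definition monochromatic_subgraph ::
    "'v pair_pre_digraph \<Rightarrow> ('v \<Rightarrow> 'c) \<Rightarrow> 'v pair_pre_digraph" where
  "monochromatic_subgraph G l =
     \<lparr>pverts = pverts G, parcs = {(u, v) \<in> parcs G. l u = l v}\<rparr>"

definition color_class :: "'v pair_pre_digraph \<Rightarrow> ('v \<Rightarrow> 'c) \<Rightarrow> 'v \<Rightarrow> 'v set" where
  "color_class G l v = {w. v \<rightarrow>\<^sup>*\<^bsub>with_proj (monochromatic_subgraph G l)\<^esub> w}"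

text \<open>
  The vertices of the contracted graph are the sets of vertices of \<open>G\<close> merged by contracting all
  monochromatic edges. All vertices in such a set have the same color, which is
  the color of the set.
\<close>

definition color_contraction ::
    "'v pair_pre_digraph \<Rightarrow> ('v \<Rightarrow> 'c) \<Rightarrow> 'v set pair_pre_digraph" where
  "color_contraction G l =
     \<lparr>pverts = color_class G l ` pverts G,
      parcs = {(color_class G l u, color_class G l v) | u v.
                 (u, v) \<in> parcs G \<and> color_class G l u \<noteq> color_class G l v}\<rparr>"

definition contracted_coloring :: "('v \<Rightarrow> 'c) \<Rightarrow> 'v set \<Rightarrow> 'c" where
  "contracted_coloring l C = the_elem (l ` C)"

section \<open>Well-definedness\<close>

lemma propagating_step_terminates:
  assumes "finite (pverts G)" "fst r \<noteq> snd r"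
  shows "\<exists>l'. while_option (applicable G r) (forcing_step G r) l = Some l'"
proof (rule measure_while_option_Some[where P = "\<lambda>_. True"
        and f = "\<lambda>l. card {v \<in> pverts G. l v = snd r}", THEN exE])
  fix l :: "'a \<Rightarrow> 'b"
  assume "applicable G r l"
  then obtain v where v: "v \<in> forced G r l" by (auto simp: applicable_def)
  have "{v \<in> pverts G. forcing_step G r l v = snd r} \<subset> {v \<in> pverts G. l v = snd r}"
    using v assms(2) by (auto simp: forcing_step_def forced_def split: if_splits)
  then show "True \<and> card {v \<in> pverts G. forcing_step G r l v = snd r}
      < card {v \<in> pverts G. l v = snd r}"
    using assms(1) by (simp add: psubset_card_mono)
qed auto

lemma pair_graph_path_graph: "pair_graph (path_graph n)"
proof -
  have "finite (parcs (path_graph n))"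
    by (rule finite_subset[of _ "{1..n} \<times> {1..n}"]) (auto simp: path_graph_def)
  then show ?thesis
    by unfold_locales (auto simp: path_graph_def symmetric_def sym_def)
qed

lemma pair_graph_color_contraction:
  assumes "pair_graph G"
  shows "pair_graph (color_contraction G l)"
proof -
  interpret pair_graph G by fact
  have "parcs (color_contraction G l)
      \<subseteq> (\<lambda>(u, v). (color_class G l u, color_class G l v)) ` parcs G"
    by (auto simp: color_contraction_def)
  then have "finite (parcs (color_contraction G l))"
    by (rule finite_subset) (use pair_finite_arcs in auto)
  moreover have "sym (parcs (color_contraction G l))"
  proof (rule symI)
    fix A B assume "(A, B) \<in> parcs (color_contraction G l)"
    then obtain u v where "A = color_class G l u" "B = color_class G l v" "(u, v) \<in> parcs G" "A \<noteq> B"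
      by (auto simp: color_contraction_def)
    moreover from this have "(v, u) \<in> parcs G"
      using pair_sym_arcs by (auto simp: symmetric_def dest: symD)
    ultimately show "(B, A) \<in> parcs (color_contraction G l)"
      unfolding color_contraction_def by auto
  qed
  moreover have "fst e \<in> pverts (color_contraction G l) \<and>
      snd e \<in> pverts (color_contraction G l) \<and> fst e \<noteq> snd e"
    if "e \<in> parcs (color_contraction G l)" for e
    using that in_arcsD1 in_arcsD2 unfolding color_contraction_def by fastforce
  moreover have "finite (pverts (color_contraction G l))"
    using pair_finite_verts by (simp add: color_contraction_def)
  ultimately show ?thesis
    by unfold_locales (simp_all add: symmetric_def)
qed

lemma contracted_coloring_color_class:
  assumes "v \<in> pverts G"
  shows "contracted_coloring l (color_class G l v) = l v"
proof -
  have "l w = l v" if "w \<in> color_class G l v" for w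
  proof -
    have "(v, w) \<in> rtrancl_on (pverts G) {(u, v) \<in> parcs G. l u = l v}"
      using that by (simp add: color_class_def reachable_def monochromatic_subgraph_def)
    then show ?thesis by induction auto
  qed
  moreover have "v \<in> color_class G l v"
    using assms by (simp add: color_class_def reachable_def monochromatic_subgraph_def)
  ultimately have "l ` color_class G l v = {l v}" by blast
  then show ?thesis by (simp add: contracted_coloring_def)
qed

end

(* A propagating step with rule (a, b) recolors exactly the vertices of color b that are joined to
   color a through vertices of color b. Hence it never recolors only one end of a monochromatic
   edge, and it makes some bichromatic edge monochromatic whenever the rule is applicable: the
   process terminates. It also commutes with pulling colorings back along a map with connected
   fibers such as the color contraction, so the end state of the graph is the pullback of the end
   state of its contraction. As any two of the three colors are related by a rule, end states on
   connected graphs are monochromatic. *)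

theory Submission
  imports Defs
begin

section \<open>Propagating steps\<close>

text \<open>Sources are not confined to \<open>pverts G\<close>, just as \<open>forced\<close> does
  not confine the recoloring neighbor; a source already has color \<open>fst r\<close>, so
  overwriting it changes nothing.\<close>

inductive captured :: "'v pair_pre_digraph \<Rightarrow> 'c \<times> 'c \<Rightarrow> ('v \<Rightarrow> 'c) \<Rightarrow> 'v \<Rightarrow> bool"
  for G r l where
  source: "l v = fst r \<Longrightarrow> captured G r l v"
| spread: "captured G r l w \<Longrightarrow> (v, w) \<in> parcs G \<Longrightarrow> v \<in> pverts G \<Longrightarrow> l v = snd r \<Longrightarrow> captured G r l v"

lemma captured_color: "captured G r l v \<Longrightarrow> l v = fst r \<or> l v = snd r"
  by (auto elim: captured.cases)

lemma captured_outside: "captured G r l v \<Longrightarrow> v \<notin> pverts G \<Longrightarrow> l v = fst r"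
  by (auto elim: captured.cases)

text \<open>The loop changes only captured vertices, by the invariant \<open>inv\<close>; and it
  cannot stop while a captured vertex still has color \<open>snd r\<close>, by induction on
  \<open>captured\<close>.\<close>

lemma propagating_step_eq:
  assumes "finite (pverts G)" "fst r \<noteq> snd r"
  shows "propagating_step G r l = (\<lambda>v. if captured G r l v then fst r else l v)"
proof -
  obtain l' where l': "while_option (applicable G r) (forcing_step G r) l = Some l'"
    using propagating_step_terminates[OF assms] by blast
  have inv: "\<forall>v. l' v = l v \<or> captured G r l v \<and> l' v = fst r"
  proof (rule while_option_rule[OF _ l'])
    fix m assume m: "\<forall>v. m v = l v \<or> captured G r l v \<and> m v = fst r"
    have "captured G r l v" if v: "v \<in> forced G r m" for v
    proof -
      obtain w where w: "(v, w) \<in> parcs G" "m w = fst r" and b: "v \<in> pverts G" "m v = snd r"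
        using v by (auto simp: forced_def)
      have "captured G r l w" using m w(2) by (metis captured.source)
      moreover have "l v = snd r" using m b(2) assms(2) by metis
      ultimately show ?thesis using w(1) b(1) by (blast intro: captured.spread)
    qed
    then show "\<forall>v. forcing_step G r m v = l v \<or> captured G r l v \<and> forcing_step G r m v = fst r"
      using m by (auto simp: forcing_step_def)
  qed auto
  have stop: "\<not> applicable G r l'"
    using while_option_stop[OF l'] .
  have captured: "l' v = fst r" if "captured G r l v" for v
    using that
  proof induction
    case (source v)
    then show ?case using inv by metis
  next
    case (spread w v)
    \<comment> \<open>By induction \<open>w\<close> ends with color \<open>fst r\<close>, so a
      \<open>v\<close> still colored \<open>snd r\<close> would be forced once more.\<close>
    then have "l' v \<noteq> snd r" using stop by (auto simp: applicable_def forced_def)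
    then show ?case using inv spread by metis
  qed
  have "l' v = (if captured G r l v then fst r else l v)" for v
    using captured[of v] inv[rule_format, of v] by auto
  then have "l' = (\<lambda>v. if captured G r l v then fst r else l v)" ..
  then show ?thesis
    using l' by (simp add: propagating_step_def while_def)
qed

lemma propagating_step_not_applicable:
  "\<not> applicable G r l \<Longrightarrow> propagating_step G r l = l"
  by (simp add: propagating_step_def while_unfold)

definition bichromatic_arcs :: "'v pair_pre_digraph \<Rightarrow> ('v \<Rightarrow> 'c) \<Rightarrow> ('v \<times> 'v) set" where
  "bichromatic_arcs G l = {(u, v) \<in> parcs G. l u \<noteq> l v}"

text \<open>If the common color is \<open>fst r\<close>, both ends are sources; if it is
  \<open>snd r\<close>, capture spreads along the edge in both directions; no other color is
  captured.\<close>

lemma (in pair_graph) captured_arc: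
  assumes "(u, v) \<in> parcs G" "l u = l v"
  shows "captured G r l u \<longleftrightarrow> captured G r l v"
proof -
  have "captured G r l y" if "captured G r l x" "(y, x) \<in> parcs G" "l x = l y" for x y
    using captured_color[OF that(1)] that in_arcsD1[OF that(2)]
    by (metis captured.source captured.spread)
  moreover have "(v, u) \<in> parcs G"
    using assms(1) pair_sym_arcs by (auto simp: symmetric_def dest: symD)
  ultimately show ?thesis
    using assms by metis
qed

lemma (in pair_graph) bichromatic_arcs_propagating_step:
  assumes "fst r \<noteq> snd r" "applicable G r l"
  shows "bichromatic_arcs G (propagating_step G r l) \<subset> bichromatic_arcs G l"
proof -
  note step = propagating_step_eq[OF pair_finite_verts assms(1)]
  obtain v w where vw: "v \<in> pverts G" "l v = snd r" "(v, w) \<in> parcs G" "l w = fst r"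
    using assms(2) by (auto simp: applicable_def forced_def)
  have "captured G r l w" using vw(4) by (rule captured.source)
  moreover from this have "captured G r l v" using vw by (blast intro: captured.spread)
  ultimately have "(v, w) \<notin> bichromatic_arcs G (propagating_step G r l)"
    by (simp add: bichromatic_arcs_def step)
  moreover have "(v, w) \<in> bichromatic_arcs G l"
    using vw assms(1) by (simp add: bichromatic_arcs_def)
  moreover have "bichromatic_arcs G (propagating_step G r l) \<subseteq> bichromatic_arcs G l"
  proof clarify
    fix x y assume "(x, y) \<in> bichromatic_arcs G (propagating_step G r l)"
    then show "(x, y) \<in> bichromatic_arcs G l"
      using captured_arc[of x y l r] by (auto simp: bichromatic_arcs_def step)
  qed
  ultimately show ?thesis by blast
qed

section \<open>Termination of the process\<close>

lemma ex_mod_shift: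
  fixes i j L :: nat
  assumes "i < L"
  shows "\<exists>d<L. (j + d) mod L = i"
proof (intro exI conjI)
  \<comment> \<open>The witness is \<open>i - j\<close> modulo \<open>L\<close>, with
    \<open>L - j mod L\<close> standing for the negative of \<open>j\<close> to avoid truncated
    subtraction.\<close>
  show "(i + (L - j mod L)) mod L < L" using assms by simp
  have "(j + (i + (L - j mod L)) mod L) mod L = (j mod L + (i + (L - j mod L))) mod L"
    by (simp add: mod_simps)
  also have "j mod L + (i + (L - j mod L)) = i + L"
    using mod_less_divisor[of L j] assms by linarith
  finally show "(j + (i + (L - j mod L)) mod L) mod L = i"
    using assms by simp
qed

text \<open>Turns of inapplicable rules keep the bichromatic arcs, so their number must be paired
  with the wait for an applicable rule. The pair decreases lexicographically; as the wait is below
  \<open>L\<close>, the weight \<open>L\<close> encodes it in one number.\<close>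

lemma (in pair_graph) end_state_terminates:
  assumes "\<forall>r \<in> set (rules N). fst r \<noteq> snd r"
  shows "\<exists>e. end_state N G l = Some e"
proof -
  define L where "L = length (rules N)"
  define rule where "rule j = rules N ! (j mod L)" for j
  define wait where "wait j m = (LEAST d. applicable G (rule (j + d)) m)" for j m
  let ?go = "\<lambda>m. \<exists>r \<in> set (rules N). applicable G r m"
  have wait: "wait j m < L" "applicable G (rule (j + wait j m)) m" if go: "?go m" for j m
  proof -
    obtain i where "i < L" "applicable G (rules N ! i) m"
      using go by (auto simp: in_set_conv_nth L_def)
    then obtain d where d: "d < L" "applicable G (rule (j + d)) m"
      using ex_mod_shift[of i L j] by (auto simp: rule_def)
    show "applicable G (rule (j + wait j m)) m"
      unfolding wait_def by (rule LeastI[of _ d]) (fact d)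
    have "wait j m \<le> d"
      unfolding wait_def by (rule Least_le) (fact d)
    then show "wait j m < L" using d by simp
  qed
  \<comment> \<open>The second summand is the number of turns until a rule is applied.\<close>
  define f where "f = (\<lambda>(j, m). L * card (bichromatic_arcs G m) + (if ?go m then wait j m else 0))"
  have "\<exists>t. while_option (\<lambda>(j, m). ?go m)
      (\<lambda>(j, m). (Suc j, propagating_step G (rules N ! (j mod length (rules N))) m)) (0, l) = Some t"
  proof (rule measure_while_option_Some[where P = "\<lambda>_. True" and f = f])
    fix s :: "nat \<times> ('a \<Rightarrow> 'b)"
    assume "case s of (j, m) \<Rightarrow> ?go m"
    then obtain j m where s: "s = (j, m)" and go: "?go m" by (cases s) auto
    let ?m' = "propagating_step G (rule j) m"
    have L: "0 < L" using wait(1)[OF go, of j] by simp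
    have f_s: "f s = L * card (bichromatic_arcs G m) + wait j m"
      using go by (simp add: f_def s)
    have "f (Suc j, ?m') < f s"
    proof (cases "applicable G (rule j) m")
      case True
      have "rule j \<in> set (rules N)" using L by (simp add: rule_def L_def)
      then have "bichromatic_arcs G ?m' \<subset> bichromatic_arcs G m"
        using True assms bichromatic_arcs_propagating_step by blast
      moreover have "finite (bichromatic_arcs G m)"
        using pair_finite_arcs by (rule finite_subset[rotated]) (auto simp: bichromatic_arcs_def)
      ultimately have "Suc (card (bichromatic_arcs G ?m')) \<le> card (bichromatic_arcs G m)"
        by (simp add: psubset_card_mono Suc_leI)
      then have "L * Suc (card (bichromatic_arcs G ?m')) \<le> L * card (bichromatic_arcs G m)"
        by (rule mult_le_mono2)
      \<comment> \<open>One lost arc frees \<open>L\<close>, which exceeds any new wait; once no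
        rule applies, the second summand is 0.\<close>
      moreover have "f (Suc j, ?m') < L * card (bichromatic_arcs G ?m') + L"
        using wait(1) L by (simp add: f_def)
      ultimately show ?thesis by (simp add: f_s)
    next
      case False
      then have m': "?m' = m" by (rule propagating_step_not_applicable)
      obtain d where d: "wait j m = Suc d"
        using False wait(2)[OF go, of j] by (cases "wait j m") auto
      \<comment> \<open>The coloring is unchanged, so the same applicable rule is one turn
        closer.\<close>
      have "wait (Suc j) m \<le> d"
        unfolding wait_def by (rule Least_le) (use wait(2)[OF go, of j] d in simp)
      moreover have "f (Suc j, ?m') = L * card (bichromatic_arcs G m) + wait (Suc j) m"
        using go by (simp add: f_def m')
      ultimately show ?thesis by (simp add: f_s d)
    qed
    then show "True \<and> f (case s of (j, m) \<Rightarrow>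
        (Suc j, propagating_step G (rules N ! (j mod length (rules N))) m)) < f s"
      by (simp add: s rule_def L_def)
  qed simp
  then show ?thesis by (auto simp: end_state_def)
qed

lemma end_state_not_applicable:
  assumes "end_state N G l = Some e" "r \<in> set (rules N)"
  shows "\<not> applicable G r e"
  using assms by (auto simp: end_state_def dest!: while_option_stop)

lemma (in pair_graph) colored_by_end_state:
  assumes "end_state N G l = Some e" "colored_by N G l"
    and "\<forall>r \<in> set (rules N). fst r \<in> colors N \<and> fst r \<noteq> snd r"
  shows "colored_by N G e"
proof -
  obtain j where run: "while_option (\<lambda>(j, l). \<exists>r \<in> set (rules N). applicable G r l)
      (\<lambda>(j, l). (Suc j, propagating_step G (rules N ! (j mod length (rules N))) l)) (0, l)
      = Some (j, e)"
    using assms(1) by (auto simp: end_state_def)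
  have "colored_by N G (snd (j, e))"
  proof (rule while_option_rule[OF _ run, where P = "\<lambda>s. colored_by N G (snd s)"])
    fix s :: "nat \<times> ('a \<Rightarrow> 'b)"
    assume col: "colored_by N G (snd s)"
      and go: "case s of (j, l) \<Rightarrow> \<exists>r \<in> set (rules N). applicable G r l"
    obtain j m where s: "s = (j, m)" by (cases s)
    \<comment> \<open>The loop condition provides a rule, so the list is nonempty and the index is
      in range.\<close>
    have "rules N ! (j mod length (rules N)) \<in> set (rules N)"
      using go s by (intro nth_mem mod_less_divisor) (auto intro: length_pos_if_in_set)
    then show "colored_by N G (snd (case s of (j, l) \<Rightarrow>
        (Suc j, propagating_step G (rules N ! (j mod length (rules N))) l)))"
      using col assms(3) by (auto simp: s colored_by_def propagating_step_eq[OF pair_finite_verts])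
  qed (use assms(2) in simp)
  then show ?thesis by simp
qed

section \<open>Pulling back colorings of the contraction\<close>

context pair_graph
begin

lemma color_class_arc:
  assumes "(u, v) \<in> parcs G" "l u = l v"
  shows "color_class G l u = color_class G l v"
proof -
  let ?E = "{(u, v) \<in> parcs G. l u = l v}"
  have arc: "color_class G l y \<subseteq> color_class G l x" if "(x, y) \<in> ?E" for x y
    using that in_arcsD1
    by (auto simp: color_class_def reachable_def monochromatic_subgraph_def
        intro: converse_rtrancl_on_into_rtrancl_on)
  have "(v, u) \<in> ?E"
    using assms pair_sym_arcs by (auto simp: symmetric_def dest: symD)
  then show ?thesis using arc[of u v] arc[of v u] assms by auto
qed

text \<open>Classes are connected by monochromatic arcs, whose ends share a class, so
  \<open>P\<close> stays constant along a path from \<open>u\<close> to \<open>v\<close>.\<close>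

lemma constant_on_color_class:
  assumes "u \<in> pverts G" "v \<in> pverts G" "color_class G l u = color_class G l v"
    and "\<And>x y. (x, y) \<in> parcs G \<Longrightarrow> color_class G l x = color_class G l y \<Longrightarrow> P x = P y"
  shows "P u = P v"
proof -
  have "v \<in> color_class G l v"
    using assms(2) by (simp add: color_class_def reachable_def monochromatic_subgraph_def)
  then have "(u, v) \<in> rtrancl_on (pverts G) {(u, v) \<in> parcs G. l u = l v}"
    using assms(3) by (auto simp: color_class_def reachable_def monochromatic_subgraph_def)
  then show ?thesis
  proof induction
    case (step x y)
    then have "P x = P y" using color_class_arc by (intro assms(4)) auto
    with step show ?case by simp
  qed simp
qed

text \<open>
  The colors outside the vertex set are irrelevant to the process; they are taken from \<open>c\<close> so that
  every coloring that is constant on the classes is equal to a pullback.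
\<close>

definition pullback :: "('a \<Rightarrow> 'b) \<Rightarrow> ('a \<Rightarrow> 'c) \<Rightarrow> ('a set \<Rightarrow> 'c) \<Rightarrow> 'a \<Rightarrow> 'c" where
  "pullback l c k = (\<lambda>v. if v \<in> pverts G then k (color_class G l v) else c v)"

text \<open>A spread in \<open>G\<close> either stays in one class or follows an arc of the
  contraction. Conversely, arcs of the contraction lift to \<open>G\<close>, and capture fills a
  whole class as soon as it reaches one vertex of it.\<close>

lemma captured_pullback:
  assumes "v \<in> pverts G"
  shows "captured G r (pullback l c k) v \<longleftrightarrow>
    captured (color_contraction G l) r k (color_class G l v)"
proof
  assume "captured G r (pullback l c k) v"
  then show "captured (color_contraction G l) r k (color_class G l v)"
    using assms
  proof induction
    case (source v)
    then show ?case by (intro captured.source) (simp add: pullback_def)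
  next
    case (spread w v)
    have w: "captured (color_contraction G l) r k (color_class G l w)"
      using spread in_arcsD2 by blast
    show ?case
    proof (cases "color_class G l v = color_class G l w")
      case False
      with spread w show ?thesis
        by (intro captured.spread[OF w]) (auto simp: color_contraction_def pullback_def)
    qed (use w in simp)
  qed
next
  have fiber: "captured G r (pullback l c k) x = captured G r (pullback l c k) y"
    if "x \<in> pverts G" "y \<in> pverts G" "color_class G l x = color_class G l y" for x y
    using that
    by (rule constant_on_color_class)
      (rule captured_arc, auto simp: pullback_def dest: in_arcsD1 in_arcsD2)
  show "captured G r (pullback l c k) v"
    if "captured (color_contraction G l) r k (color_class G l v)"
    using that assms
  proof (induction "color_class G l v" arbitrary: v)
    case source
    then show ?case by (intro captured.source) (simp add: pullback_def)
  next
    case (spread D)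
    then obtain u w where uw: "(u, w) \<in> parcs G" "color_class G l v = color_class G l u"
        "D = color_class G l w"
      by (auto simp: color_contraction_def)
    have "u \<in> pverts G" "w \<in> pverts G"
      using uw(1) in_arcsD1 in_arcsD2 by blast+
    moreover from this have "captured G r (pullback l c k) w"
      using spread uw by blast
    ultimately have "captured G r (pullback l c k) u"
      using spread uw by (intro captured.spread[of _ _ _ w u]) (simp_all add: pullback_def)
    \<comment> \<open>The lifted arc starts at some \<open>u\<close> in the class of
      \<open>v\<close>, which may differ from \<open>v\<close>; \<open>fiber\<close> carries capture
      over.\<close>
    then show ?case
      using fiber[of u v] uw(2) \<open>u \<in> pverts G\<close> spread.prems by simp
  qed
qed

text \<open>An arc between two different colors joins different classes and so survives the
  contraction; conversely, arcs lift.\<close>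

lemma applicable_pullback:
  assumes "fst r \<noteq> snd r"
  shows "applicable G r (pullback l c k) \<longleftrightarrow> applicable (color_contraction G l) r k"
proof
  assume "applicable G r (pullback l c k)"
  then obtain v w where vw: "v \<in> pverts G" "(v, w) \<in> parcs G"
      "pullback l c k v = snd r" "pullback l c k w = fst r"
    by (auto simp: applicable_def forced_def)
  then have "k (color_class G l v) = snd r" "k (color_class G l w) = fst r"
    using in_arcsD2 by (auto simp: pullback_def)
  moreover from this have "color_class G l v \<noteq> color_class G l w" using assms by auto
  ultimately have "color_class G l v \<in> forced (color_contraction G l) r k"
    using vw(1,2) by (auto simp: forced_def color_contraction_def)
  then show "applicable (color_contraction G l) r k" by (auto simp: applicable_def)
next
  assume "applicable (color_contraction G l) r k"
  then obtain C D where CD: "(C, D) \<in> parcs (color_contraction G l)" "k C = snd r" "k D = fst r"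
    by (auto simp: applicable_def forced_def)
  then obtain u w where uw: "(u, w) \<in> parcs G" "C = color_class G l u" "D = color_class G l w"
    by (auto simp: color_contraction_def)
  then have "u \<in> pverts G" "w \<in> pverts G"
    using in_arcsD1 in_arcsD2 by blast+
  then have "u \<in> forced G r (pullback l c k)"
    using uw CD by (auto simp: forced_def pullback_def)
  then show "applicable G r (pullback l c k)" by (auto simp: applicable_def)
qed

lemma propagating_step_pullback:
  assumes "fst r \<noteq> snd r"
  shows "propagating_step G r (pullback l c k) =
    pullback l c (propagating_step (color_contraction G l) r k)"
proof
  interpret H: pair_graph "color_contraction G l"
    by (rule pair_graph_color_contraction) unfold_locales
  fix v
  show "propagating_step G r (pullback l c k) v =
      pullback l c (propagating_step (color_contraction G l) r k) v"
  proof (cases "v \<in> pverts G")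
    case True
    then show ?thesis
      by (simp add: propagating_step_eq assms captured_pullback)
        (simp add: pullback_def propagating_step_eq assms)
  next
    case False
    \<comment> \<open>Outside the vertex set only vertices already colored \<open>fst r\<close> are
      captured, so both sides equal \<open>c v\<close>.\<close>
    then show ?thesis
      using captured_outside[of G r "pullback l c k" v]
      by (simp add: propagating_step_eq assms) (auto simp: pullback_def)
  qed
qed

text \<open>Both loops run in lockstep with the same turn counter, since pulling back preserves the
  loop condition and commutes with every turn.\<close>

lemma end_state_pullback:
  assumes "\<forall>r \<in> set (rules N). fst r \<noteq> snd r"
  shows "end_state N G (pullback l c k) =
    map_option (pullback l c) (end_state N (color_contraction G l) k)"
proof -
  let ?b = "\<lambda>G (j :: nat, l). \<exists>r \<in> set (rules N). applicable G r l"
  let ?c = "\<lambda>G (j, l). (Suc j, propagating_step G (rules N ! (j mod length (rules N))) l)"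
  have "map_option (map_prod id (pullback l c))
      (while_option (?b (color_contraction G l)) (?c (color_contraction G l)) (0, k)) =
      while_option (?b G) (?c G) (map_prod id (pullback l c) (0, k))"
  proof (rule while_option_commute)
    fix s show "?b (color_contraction G l) s = ?b G (map_prod id (pullback l c) s)"
      using assms by (auto simp: applicable_pullback split: prod.splits)
  next
    fix s assume "?b (color_contraction G l) s"
    moreover obtain j m where s: "s = (j, m)" by (cases s)
    ultimately have "rules N ! (j mod length (rules N)) \<in> set (rules N)"
      by (intro nth_mem mod_less_divisor) (auto intro: length_pos_if_in_set)
    then show "map_prod id (pullback l c) (?c (color_contraction G l) s) =
        ?c G (map_prod id (pullback l c) s)"
      using assms by (simp add: s propagating_step_pullback)
  qed
  from arg_cong[OF this, of "map_option snd"] show ?thesis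
    by (simp add: end_state_def option.map_comp comp_def)
qed

lemma pullback_contracted_coloring: "pullback l l (contracted_coloring l) = l"
  by (auto simp: pullback_def contracted_coloring_color_class)

end

section \<open>The 3-cyclic forcing network\<close>

text \<open>Two different colors are related by a rule in exactly one direction, which decides the
  end to be recolored; hence arcs both ways are assumed.\<close>

lemma cyclic3_no_rule_applicable:
  assumes "colored_by cyclic3 G e" "\<forall>r \<in> set (rules cyclic3). \<not> applicable G r e"
    and "(u, v) \<in> parcs G" "(v, u) \<in> parcs G" "u \<in> pverts G" "v \<in> pverts G"
  shows "e u = e v"
proof (rule ccontr)
  assume "e u \<noteq> e v"
  moreover have "e u \<in> {1, 2, 3}" "e v \<in> {1, 2, 3}"
    using assms(1,5,6) by (auto simp: colored_by_def cyclic3_def)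
  ultimately have "(e u, e v) \<in> set (rules cyclic3) \<or> (e v, e u) \<in> set (rules cyclic3)"
    by (auto simp: cyclic3_def)
  moreover have "applicable G (e u, e v) e" "applicable G (e v, e u) e"
    using assms(3-) by (auto simp: applicable_def forced_def)
  ultimately show False
    using assms(2) by blast
qed

theorem theorem4p8:
  fixes n :: nat and l :: "nat \<Rightarrow> nat"
  assumes "n \<ge> 1"
    and "colored_by cyclic3 (path_graph n) l"
  shows "\<exists>i \<in> {1, 2, 3}.
     (\<exists>e. end_state cyclic3 (path_graph n) l = Some e \<and>
          (\<forall>v \<in> pverts (path_graph n). e v = i)) \<and>
     (\<exists>e'. end_state cyclic3 (color_contraction (path_graph n) l) (contracted_coloring l) = Some e' \<and>
          (\<forall>C \<in> pverts (color_contraction (path_graph n) l). e' C = i))"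
proof -
  interpret pair_graph "path_graph n" by (rule pair_graph_path_graph)
  have rules: "\<forall>r \<in> set (rules cyclic3). fst r \<in> colors cyclic3 \<and> fst r \<noteq> snd r"
    by (auto simp: cyclic3_def)
  then obtain e where e: "end_state cyclic3 (path_graph n) l = Some e"
    using end_state_terminates[of cyclic3 l] by auto
  have col: "colored_by cyclic3 (path_graph n) e"
    by (rule colored_by_end_state[OF e assms(2) rules])
  have stop: "\<forall>r \<in> set (rules cyclic3). \<not> applicable (path_graph n) r e"
    using end_state_not_applicable[OF e] by blast
  have mono: "e v = e 1" if "1 \<le> v" "v \<le> n" for v
    using that
  proof (induction v rule: dec_induct)
    case (step v)
    have "e v = e (Suc v)"
      by (rule cyclic3_no_rule_applicable[OF col stop]) (use step in \<open>auto simp: path_graph_def\<close>)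
    with step show ?case by simp
  qed simp
  have end_eq: "end_state cyclic3 (path_graph n) l = map_option (pullback l l)
      (end_state cyclic3 (color_contraction (path_graph n) l) (contracted_coloring l))"
    using end_state_pullback[of cyclic3 l l "contracted_coloring l"] rules
    by (simp add: pullback_contracted_coloring)
  \<comment> \<open>Termination on the contraction is inherited from termination on the
    path.\<close>
  then obtain e' where
    e': "end_state cyclic3 (color_contraction (path_graph n) l) (contracted_coloring l) = Some e'"
      "e = pullback l l e'"
    using e by (metis map_option_eq_Some)
  have "e' C = e 1" if C: "C \<in> pverts (color_contraction (path_graph n) l)" for C
  proof -
    obtain v where v: "v \<in> pverts (path_graph n)" "C = color_class (path_graph n) l v"
      using C by (auto simp: color_contraction_def)
    then have "e' C = e v" by (simp add: e'(2) pullback_def)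
    also have "\<dots> = e 1" using v(1) by (intro mono) (auto simp: path_graph_def)
    finally show ?thesis .
  qed
  \<comment> \<open>Vertex 1 exists because \<open>n \<ge> 1\<close>.\<close>
  moreover have "e 1 \<in> {1, 2, 3}"
    using col assms(1) by (auto simp: colored_by_def cyclic3_def path_graph_def)
  moreover have "\<forall>v \<in> pverts (path_graph n). e v = e 1"
    by (intro ballI mono) (auto simp: path_graph_def)
  ultimately show ?thesis
    using e e'(1) by blast
qed

end
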